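(* Let $c\in[0,2\pi]$. In the single-agent partial disk inspection problem $\mathcal P(c)$ (defined in the context), the optimal (minimum over all feasible trajectories) worst-case inspection cost equals $$ \begin{cases} \dfrac{1}{\cos(c/2)}, & \text{if } 0 \leq c \leq \frac{2\pi}{3}, \\[2mm] 1 - 2\cos(c), & \text{if } \frac{2\pi}{3} < c \leq \frac{5\pi}{6}, \\[2mm] 1 + \sqrt{3} + c - \frac{5\pi}{6}, & \text{if } \frac{5\pi}{6} < c \leq 2\pi. \end{cases} $$
   Context: Let $D$ be the closed unit disk centered at the origin $O$ of $\mathbb R^2$, and write $\mathcal P_t=(\cos t,\sin t)$ for points of its boundary circle. An agent located at a point $A\in\mathbb R^2$ inspects a boundary point $P$ if no convex combination of $A$ and $P$ lies in the interior of $D$ (i.e. the closed segment $AP$ avoids the open unit disk). A trajectory of a unit-speed agent is a continuous path $\gamma:[0,\infty)\to\mathbb R^2$ with $\gamma(0)=O$ and $\|\gamma(s)-\gamma(s')\|\le |s-s'|$; the inspection time $\mathrm{insp}(P)$ of a boundary point $P$ is the first time $s$ at which the agent's position $\gamma(s)$ inspects $P$. In the problem $\mathcal P(c)$, a single unit-speed agent starting at $O$ must inspect all points of an arc of the boundary of length $c$ (without loss of generality the arc $\{\mathcal P_\phi:\phi\in[0,c]\}$); a trajectory is feasible if it inspects every point of that arc, and its worst-case inspection cost is $\sup_{\phi\in[0,c]}\mathrm{insp}(\mathcal P_\phi)$. *)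

theory Defs
  imports "HOL-Analysis.Analysis"
begin

definition unit_disk :: "(real^2) set" where
  "unit_disk = cball 0 1"

definition circle_pt :: "real \<Rightarrow> real^2" where
  "circle_pt t = vector [cos t, sin t]"

definition inspects :: "real^2 \<Rightarrow> real^2 \<Rightarrow> bool" where
  "inspects A P \<longleftrightarrow> closed_segment A P \<inter> interior unit_disk = {}"

text \<open>Values of a trajectory at negative times are irrelevant.\<close>

definition trajectory :: "(real \<Rightarrow> real^2) \<Rightarrow> bool" where
  "trajectory \<gamma> \<longleftrightarrow>
     continuous_on {0..} \<gamma> \<and> \<gamma> 0 = 0 \<and>
     (\<forall>s\<ge>0. \<forall>s'\<ge>0. norm (\<gamma> s - \<gamma> s') \<le> \<bar>s - s'\<bar>)"

definition feasible :: "real \<Rightarrow> (real \<Rightarrow> real^2) \<Rightarrow> bool" where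
  "feasible c \<gamma> \<longleftrightarrow>
     trajectory \<gamma> \<and> (\<forall>\<phi>\<in>{0..c}. \<exists>s\<ge>0. inspects (\<gamma> s) (circle_pt \<phi>))"

text \<open>
  The first inspection time. It is only meaningful for points that are inspected at all;
  for those the minimum exists, see \<open>insp_time_first\<close> below.
\<close>

definition insp_time :: "(real \<Rightarrow> real^2) \<Rightarrow> real^2 \<Rightarrow> real" where
  "insp_time \<gamma> P = (LEAST s. 0 \<le> s \<and> inspects (\<gamma> s) P)"

text \<open>
  The cost is extended-real valued: a feasible trajectory inspects every point of the arc
  at a finite time, but the supremum of these times may be infinite.
\<close>

definition inspection_cost :: "real \<Rightarrow> (real \<Rightarrow> real^2) \<Rightarrow> ereal" where
  "inspection_cost c \<gamma> = (SUP \<phi>\<in>{0..c}. ereal (insp_time \<gamma> (circle_pt \<phi>)))"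

lemma closed_inspects: "closed {A. inspects A P}"
proof -
  have "{A. inspects A P} =
    (\<Inter>u\<in>{0..1}. (\<lambda>A. (1 - u) *\<^sub>R A + u *\<^sub>R P) -` (- interior unit_disk))"
    by (auto simp: inspects_def closed_segment_image_interval disjoint_iff)
  moreover have "closed ((\<lambda>A. (1 - u) *\<^sub>R A + u *\<^sub>R P) -` (- interior unit_disk))" for u
    by (intro closed_vimage closed_Compl open_interior continuous_intros)
  ultimately show ?thesis by auto
qed

lemma insp_time_first:
  assumes "trajectory \<gamma>" and "0 \<le> s" and "inspects (\<gamma> s) P"
  shows "0 \<le> insp_time \<gamma> P" and "inspects (\<gamma> (insp_time \<gamma> P)) P" and "insp_time \<gamma> P \<le> s"
proof -
  let ?T = "{0..} \<inter> \<gamma> -` {A. inspects A P}"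
  have "closed ?T"
    using assms(1) closed_inspects
    by (intro continuous_closed_preimage) (auto simp: trajectory_def)
  moreover have "?T \<noteq> {}" and "bdd_below ?T"
    using assms by (auto intro: bdd_belowI[of _ 0])
  ultimately have "Inf ?T \<in> ?T"
    by (intro closed_contains_Inf)
  moreover have "Inf ?T \<le> t" if "0 \<le> t" "inspects (\<gamma> t) P" for t
    using that \<open>bdd_below ?T\<close> by (intro cInf_lower) auto
  ultimately have first: "0 \<le> Inf ?T \<and> inspects (\<gamma> (Inf ?T)) P"
    and min: "\<And>t. 0 \<le> t \<and> inspects (\<gamma> t) P \<Longrightarrow> Inf ?T \<le> t"
    by auto
  have "insp_time \<gamma> P = Inf ?T"
    unfolding insp_time_def by (rule Least_equality) (use first min in auto)
  then show "0 \<le> insp_time \<gamma> P" "inspects (\<gamma> (insp_time \<gamma> P)) P" "insp_time \<gamma> P \<le> s"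
    using first min assms by auto
qed

end

theory Submission
  imports Defs
begin

text \<open>
  A point \<open>A\<close> inspects \<open>P\<close> iff it lies beyond the tangent line at \<open>P\<close>. For \<open>c \<le> 5\<pi>/6\<close> the lower
  bound only uses the tangents at the two ends of the arc. For larger \<open>c\<close> the difficulty is that
  the arc may be inspected in any order. Finitely many positions of the agent suffice (after
  shrinking the disk a little); each of them inspects an arc around its polar angle. Keep the
  distances of these positions from the origin, but replace every change of the polar angle by an
  increasing one, cut off so that no gap opens between consecutive arcs. Distances between
  consecutive positions do not increase, and the new arcs form a chain of overlapping intervals
  whose total extent is still at least \<open>c\<close>, now inspected from left to right. For such a chain
  the bound follows by projecting every step to the tangent direction at an angle that both of its
  ends inspect.
\<close>

section \<open>Polar coordinates and inspection as a half-plane condition\<close>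

lemma inner_circle_pt [simp]: "circle_pt s \<bullet> circle_pt t = cos (s - t)"
  by (simp add: circle_pt_def inner_vec_def sum_2 cos_diff)

lemma norm_circle_pt [simp]: "norm (circle_pt t) = 1"
  by (simp add: norm_eq_sqrt_inner)

lemma real2_polar:
  fixes x :: "real^2"
  obtains \<theta> where "x = norm x *\<^sub>R circle_pt \<theta>"
proof (cases "x = 0")
  case False
  then have n: "norm x > 0" by simp
  have "(x$1)\<^sup>2 + (x$2)\<^sup>2 = (norm x)\<^sup>2"
    unfolding power2_norm_eq_inner by (simp add: inner_vec_def sum_2 power2_eq_square)
  then have "(x$1 / norm x)\<^sup>2 + (x$2 / norm x)\<^sup>2 = 1"
    using n by (simp add: power_divide flip: add_divide_distrib)
  then obtain t where "x$1 / norm x = cos t" "x$2 / norm x = sin t"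
    by (rule sincos_total_2pi)
  then have "x $ 1 = norm x * cos t" "x $ 2 = norm x * sin t"
    using n by (auto simp: nonzero_divide_eq_eq mult.commute)
  then have "x = norm x *\<^sub>R circle_pt t"
    by (subst vec_eq_iff) (simp add: forall_2 circle_pt_def)
  then show ?thesis by (rule that)
qed (use that in simp)

text \<open>The half-plane beyond the tangent at \<open>circle_pt t\<close> is convex and misses the
  open disk, so it contains the whole segment when it contains \<open>A\<close>. If \<open>A\<close>
  lies strictly on the other side, a short move from the boundary point towards \<open>A\<close>
  enters the open disk.\<close>

lemma inspects_circle_pt_iff: "inspects A (circle_pt t) \<longleftrightarrow> 1 \<le> A \<bullet> circle_pt t"
proof
  assume in1: "1 \<le> A \<bullet> circle_pt t"
  have "norm x \<ge> 1" if seg: "x \<in> closed_segment A (circle_pt t)" for x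
  proof -
    obtain u where u: "0 \<le> u" "u \<le> 1" "x = (1 - u) *\<^sub>R A + u *\<^sub>R circle_pt t"
      using seg unfolding in_segment by blast
    have "x \<bullet> circle_pt t = (1 - u) * (A \<bullet> circle_pt t) + u"
      unfolding u(3) by (simp add: inner_add_left)
    moreover have "1 - u \<le> (1 - u) * (A \<bullet> circle_pt t)"
      using mult_left_mono[OF in1, of "1 - u"] u(2) by simp
    moreover have "x \<bullet> circle_pt t \<le> norm x"
      using norm_cauchy_schwarz[of x "circle_pt t"] by (simp only: norm_circle_pt mult_1_right)
    ultimately show ?thesis by linarith
  qed
  then show "inspects A (circle_pt t)"
    unfolding inspects_def unit_disk_def interior_cball disjoint_iff mem_ball_0 not_less by blast
next
  assume ins: "inspects A (circle_pt t)"
  show "1 \<le> A \<bullet> circle_pt t"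
  proof (rule ccontr)
    assume neg: "\<not> ?thesis"
    define k where "k = 1 - A \<bullet> circle_pt t"
    define m where "m = (norm (A - circle_pt t))\<^sup>2"
    have k: "k > 0" using neg by (simp add: k_def)
    have "m \<ge> 0" by (simp add: m_def)
    \<comment> \<open>The step length must satisfy \<open>u * m < k\<close>, which makes
      \<open>1 - 2 * u * k + u\<^sup>2 * m\<close> smaller than 1. The denominator
      \<open>m + 1\<close> avoids a division by zero.\<close>
    define u where "u = min 1 (k / (m + 1))"
    have u: "0 < u" "u \<le> 1" "u * (m + 1) \<le> k"
      using k \<open>m \<ge> 0\<close> by (simp_all add: u_def min_def pos_le_divide_eq)
    have "u * m < k" using u by (simp add: algebra_simps)
    define x where "x = u *\<^sub>R A + (1 - u) *\<^sub>R circle_pt t"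
    have x_eq: "x = circle_pt t + u *\<^sub>R (A - circle_pt t)"
      by (simp add: x_def algebra_simps)
    have "(norm x)\<^sup>2 = 1 - 2 * u * k + u\<^sup>2 * m"
      unfolding x_eq m_def k_def power2_norm_eq_inner
      by (simp add: inner_simps inner_commute power2_eq_square) (simp add: algebra_simps)
    also have "\<dots> = 1 - u * k - u * (k - u * m)"
      by (simp add: power2_eq_square algebra_simps)
    also have "\<dots> < 1"
      using mult_pos_pos[OF u(1) k] mult_pos_pos[of u "k - u * m"] u(1) \<open>u * m < k\<close> by linarith
    finally have "norm x < 1" by (simp add: abs_square_less_1)
    moreover have "x \<in> closed_segment A (circle_pt t)"
      unfolding in_segment using u by (intro exI[of _ "1 - u"]) (simp add: x_def)
    ultimately show False
      using ins unfolding inspects_def unit_disk_def interior_cball disjoint_iff mem_ball_0 by blast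
  qed
qed

section \<open>Two tangent lines\<close>

text \<open>Both tangent inequalities are added with the same weight \<open>\<mu>\<close>, chosen so
  that \<open>\<mu> *\<^sub>R (E + F)\<close> is the unit vector along the bisector. The leftover
  coefficient of \<open>q - p\<close> is then \<open>\<mu> *\<^sub>R F\<close>, of norm at most 1
  exactly because \<open>c \<le> 2 * pi / 3\<close>.\<close>

lemma two_points_bound_corner:
  fixes p q E F :: "real^2"
  assumes "norm E = 1" "norm F = 1" "E \<bullet> F = cos c" "0 \<le> c" "c \<le> 2 * pi / 3"
    and "1 \<le> p \<bullet> E" "1 \<le> q \<bullet> F"
  shows "1 / cos (c / 2) \<le> norm p + norm (q - p)"
proof -
  have "cos (pi / 3) \<le> cos (c / 2)"
    using assms(4,5) by (intro cos_monotone_0_pi_le) auto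
  then have C: "cos (c / 2) \<ge> 1 / 2" by (simp add: cos_60)
  define \<mu> where "\<mu> = 1 / (2 * cos (c / 2))"
  have \<mu>: "0 < \<mu>" "\<mu> \<le> 1" using C by (auto simp: \<mu>_def field_simps)
  have "(norm (E + F))\<^sup>2 = 2 + 2 * cos c"
    using assms(1-3) by (simp add: power2_norm_eq_inner inner_simps inner_commute norm_eq_1)
  also have "\<dots> = (2 * cos (c / 2))\<^sup>2"
    using cos_double_cos[of "c / 2"] by (simp add: power_mult_distrib)
  finally have "norm (E + F) = 2 * cos (c / 2)"
    using C by (subst (asm) power2_eq_iff_nonneg) auto
  then have u: "norm (\<mu> *\<^sub>R (E + F)) = 1"
    using C by (simp add: \<mu>_def del: scaleR_add_right)
  have "1 / cos (c / 2) = \<mu> * (1 + 1)" by (simp add: \<mu>_def)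
  also have "\<dots> \<le> \<mu> * (p \<bullet> E + q \<bullet> F)"
    using assms(6,7) \<mu> by (intro mult_left_mono) auto
  also have "\<dots> = p \<bullet> (\<mu> *\<^sub>R (E + F)) + (q - p) \<bullet> (\<mu> *\<^sub>R F)"
    by (simp add: inner_simps algebra_simps)
  also have "\<dots> \<le> norm p * 1 + norm (q - p) * \<mu>"
  proof (rule add_mono)
    show "p \<bullet> (\<mu> *\<^sub>R (E + F)) \<le> norm p * 1"
      using norm_cauchy_schwarz[of p "\<mu> *\<^sub>R (E + F)"] unfolding u .
    show "(q - p) \<bullet> (\<mu> *\<^sub>R F) \<le> norm (q - p) * \<mu>"
      using norm_cauchy_schwarz[of "q - p" "\<mu> *\<^sub>R F"] \<mu>(1) assms(2) by simp
  qed
  also have "\<dots> \<le> norm p + norm (q - p)"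
    using \<mu> mult_left_mono[of \<mu> 1 "norm (q - p)"] by auto
  finally show ?thesis .
qed

text \<open>A mirror argument: \<open>F + l *\<^sub>R E\<close> with \<open>l = - 2 * cos c\<close>
  is the reflection of \<open>F\<close> in the line orthogonal to \<open>E\<close>, hence a unit
  vector. The bound is the distance from the origin to the tangent at \<open>F\<close> after
  mirroring it in the tangent at \<open>E\<close>.\<close>

lemma two_points_bound_reflect:
  fixes p q E F :: "real^2"
  assumes "norm E = 1" "norm F = 1" "E \<bullet> F = cos c" "cos c \<le> 0"
    and "1 \<le> p \<bullet> E" "1 \<le> q \<bullet> F"
  shows "1 - 2 * cos c \<le> norm p + norm (q - p)"
proof -
  define l where "l = - 2 * cos c"
  have l: "l \<ge> 0" using assms by (simp add: l_def)
  have "(norm (F + l *\<^sub>R E))\<^sup>2 = 1 + 2 * l * cos c + l\<^sup>2"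
    using assms(1-3) by (simp add: power2_norm_eq_inner inner_simps inner_commute norm_eq_1)
      (simp add: power2_eq_square algebra_simps)
  also have "\<dots> = 1\<^sup>2" by (simp add: l_def power2_eq_square)
  finally have u: "norm (F + l *\<^sub>R E) = 1"
    by (subst (asm) power2_eq_iff_nonneg) auto
  have "1 - 2 * cos c \<le> l * (p \<bullet> E) + q \<bullet> F"
    using mult_left_mono[OF assms(5) l] assms(6) by (simp add: l_def)
  also have "\<dots> = p \<bullet> (F + l *\<^sub>R E) + (q - p) \<bullet> F"
    by (simp add: inner_simps)
  also have "\<dots> \<le> norm p + norm (q - p)"
    using norm_cauchy_schwarz[of p "F + l *\<^sub>R E"] norm_cauchy_schwarz[of "q - p" F] u assms(2)
    by simp
  finally show ?thesis .
qed

section \<open>Chains of overlapping intervals\<close>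

text \<open>The function \<open>sin x / cos a - x\<close> increases as long as
  \<open>\<bar>x\<bar> \<le> a\<close>. For a position at distance \<open>1 / cos a\<close>, the
  value \<open>sin w / cos a\<close> is minus its coordinate along the tangent direction at angular
  offset \<open>w\<close>, so turning that direction within the inspected arc changes the coordinate
  by at least the angle turned.\<close>

lemma sec_sin_increment_ge:
  assumes "0 \<le> a" "a < pi / 2" "- a \<le> w'" "w' \<le> w" "w \<le> a"
  shows "w - w' \<le> sin w / cos a - sin w' / cos a"
proof -
  have "cos a > 0" using assms by (intro cos_gt_zero_pi) auto
  have "sin w' / cos a - w' \<le> sin w / cos a - w"
  proof (rule DERIV_nonneg_imp_nondecreasing[OF assms(4), of "\<lambda>w. sin w / cos a - w"])
    fix x assume x: "w' \<le> x" "x \<le> w"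
    have "cos a \<le> cos \<bar>x\<bar>" using assms x by (intro cos_monotone_0_pi_le) auto
    then have "cos x / cos a - 1 \<ge> 0" using \<open>cos a > 0\<close> by simp
    moreover have "((\<lambda>w. sin w / cos a - w) has_real_derivative cos x / cos a - 1) (at x)"
      using \<open>cos a > 0\<close> by (auto intro!: derivative_eq_intros)
    ultimately show "\<exists>y. ((\<lambda>w. sin w / cos a - w) has_real_derivative y) (at x) \<and> 0 \<le> y"
      by blast
  qed
  then show ?thesis by simp
qed

lemma sec_sin_increment_le:
  assumes "0 \<le> a" "a < pi / 2" "a \<le> w'" "w' \<le> w" "w \<le> pi"
  shows "sin w / cos a - sin w' / cos a \<le> w - w'"
proof -
  have "cos a > 0" using assms by (intro cos_gt_zero_pi) auto
  have "sin w' / cos a - w' \<ge> sin w / cos a - w"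
  proof (rule DERIV_nonpos_imp_nonincreasing[OF assms(4), of "\<lambda>w. sin w / cos a - w"])
    fix x assume x: "w' \<le> x" "x \<le> w"
    have "cos x \<le> cos a" using assms x by (intro cos_monotone_0_pi_le) auto
    then have "cos x / cos a - 1 \<le> 0" using \<open>cos a > 0\<close> by simp
    moreover have "((\<lambda>w. sin w / cos a - w) has_real_derivative cos x / cos a - 1) (at x)"
      using \<open>cos a > 0\<close> by (auto intro!: derivative_eq_intros)
    ultimately show "\<exists>y. ((\<lambda>w. sin w / cos a - w) has_real_derivative y) (at x) \<and> y \<le> 0"
      by blast
  qed
  then show ?thesis by simp
qed

text \<open>On the interval from \<open>- a\<close> to \<open>pi\<close> the function
  \<open>sin x / cos a - x\<close> rises up to \<open>a\<close> and falls afterwards. The point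
  \<open>w\<close> lies between \<open>v\<close> and this peak, or is the peak itself when
  \<open>v\<close> exceeds \<open>a\<close>.\<close>

lemma sec_sin_increment_clamped:
  assumes "0 \<le> a" "a < pi / 2" "w \<le> a" "min a v \<le> w" "- a \<le> v" "v \<le> pi"
  shows "w - v \<le> sin w / cos a - sin v / cos a"
proof (cases "v \<le> w")
  case True
  then show ?thesis using assms by (intro sec_sin_increment_ge) auto
next
  case False
  then have "w = a" using assms by auto
  then show ?thesis using sec_sin_increment_le[of a a v] assms False by auto
qed

text \<open>Cost of the beginning: the tangent point \<open>pi / 3\<close> past the left end of the
  arc cannot be reached before time \<open>sqrt 3\<close>. The case \<open>w = pi / 3 - a\<close>
  reduces to \<open>cos (a - pi / 6) \<le> 1\<close>, with equality at \<open>a = pi / 6\<close>,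
  the first corner of the optimal path; any other \<open>w\<close> follows by clamping.\<close>

lemma chain_start:
  assumes "0 \<le> a" "a < pi / 2" "w \<le> a" "min (2 * a) (pi / 3) - a \<le> w"
  shows "sqrt 3 - pi / 3 + w + a \<le> 1 / cos a + sin w / cos a"
proof -
  have c0: "cos a > 0" using assms by (intro cos_gt_zero_pi) auto
  have "cos (a - pi / 6) \<le> 1" by simp
  then have "sqrt 3 * cos a \<le> 1 + sin (pi / 3 - a)"
    unfolding cos_diff sin_diff by (simp add: cos_30 sin_30 sin_60 cos_60 field_simps)
  then have "sqrt 3 \<le> 1 / cos a + sin (pi / 3 - a) / cos a"
    using c0 by (simp add: field_simps)
  moreover have "w - (pi / 3 - a) \<le> sin w / cos a - sin (pi / 3 - a) / cos a"
    using assms by (intro sec_sin_increment_clamped) auto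
  ultimately show ?thesis by simp
qed

text \<open>Cost of the ending: the last stretch of angle \<open>pi / 2\<close> can be inspected by
  a tangential move of length 1, and \<open>w = pi / 2 - a\<close> gives exactly this value.\<close>

lemma chain_end:
  assumes "0 \<le> a" "a < pi / 2" "w \<le> a" "min (2 * a) (pi / 2) - a \<le> w"
  shows "1 - pi / 2 + w + a \<le> sin w / cos a"
proof -
  have c0: "cos a > 0" using assms by (intro cos_gt_zero_pi) auto
  have "sin (pi / 2 - a) / cos a = 1"
    using c0 by (simp add: sin_diff)
  moreover have "w - (pi / 2 - a) \<le> sin w / cos a - sin (pi / 2 - a) / cos a"
    using assms by (intro sec_sin_increment_clamped) auto
  ultimately show ?thesis by simp
qed

text \<open>Cauchy-Schwarz against the unit tangent vector
  \<open>circle_pt (\<beta> + pi / 2)\<close> at angle \<open>\<beta>\<close>.\<close>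

lemma chain_step:
  "r * sin (\<beta> - s) - r' * sin (\<beta> - t) \<le> norm (r' *\<^sub>R circle_pt t - r *\<^sub>R circle_pt s)"
proof -
  have "(r' *\<^sub>R circle_pt t - r *\<^sub>R circle_pt s) \<bullet> circle_pt (\<beta> + pi / 2)
      = r * sin (\<beta> - s) - r' * sin (\<beta> - t)"
    by (simp add: inner_diff_left cos_diff cos_add sin_add sin_diff algebra_simps)
  then show ?thesis
    using norm_cauchy_schwarz[of "r' *\<^sub>R circle_pt t - r *\<^sub>R circle_pt s" "circle_pt (\<beta> + pi / 2)"]
    by simp
qed

text \<open>The sum of the bounds for three stretches: \<open>pi / 3\<close> at the start costs
  \<open>sqrt 3\<close>, \<open>pi / 2\<close> at the end costs 1, and the angle in between costs
  its own length. The induction carries the tangential coordinate of the current position as a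
  correction term.\<close>

lemma chain_bound:
  fixes \<theta> a :: "nat \<Rightarrow> real"
  defines "y \<equiv> \<lambda>i. (1 / cos (a i)) *\<^sub>R circle_pt (\<theta> i)"
  assumes a: "\<And>i. i \<le> n \<Longrightarrow> 0 \<le> a i \<and> a i < pi / 2"
    and lo: "\<And>i. i < n \<Longrightarrow> \<theta> i - a i \<le> \<theta> (Suc i) - a (Suc i)"
    and hi: "\<And>i. i < n \<Longrightarrow> \<theta> i + a i \<le> \<theta> (Suc i) + a (Suc i)"
    and ov: "\<And>i. i < n \<Longrightarrow> \<theta> (Suc i) - a (Suc i) \<le> \<theta> i + a i"
    and ext: "5 * pi / 6 \<le> (\<theta> n + a n) - (\<theta> 0 - a 0)"
  shows "1 + sqrt 3 - 5 * pi / 6 + (\<theta> n + a n) - (\<theta> 0 - a 0)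
    \<le> norm (y 0) + (\<Sum>i<n. norm (y (Suc i) - y i))"
proof -
  define \<tau> where "\<tau> = \<theta> 0 - a 0 + pi / 3"
  \<comment> \<open>\<open>K i\<close> is \<open>\<tau>\<close> clamped to the \<open>i\<close>-th
    interval, and so an angle that the \<open>i\<close>-th position inspects.\<close>
  define K where "K = (\<lambda>i. min (\<theta> i + a i) (max (\<theta> i - a i) \<tau>))"
  have cpos: "cos (a i) > 0" if "i \<le> n" for i
    using a[OF that] by (intro cos_gt_zero_pi) auto
  have main: "sqrt 3 - pi / 3 + (K m - (\<theta> 0 - a 0)) - sin (K m - \<theta> m) / cos (a m)
      \<le> norm (y 0) + (\<Sum>i<m. norm (y (Suc i) - y i))" if "m \<le> n" for m
    using that
  proof (induction m)
    case 0
    have "norm (y 0) = 1 / cos (a 0)" using cpos[of 0] by (simp add: y_def)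
    moreover have "sqrt 3 - pi / 3 + (K 0 - \<theta> 0) + a 0 \<le> 1 / cos (a 0) + sin (K 0 - \<theta> 0) / cos (a 0)"
      using a[of 0] by (intro chain_start) (auto simp: K_def \<tau>_def)
    ultimately show ?case by simp
  next
    case (Suc m)
    \<comment> \<open>\<open>\<tau>\<close> clamped to the overlap of the two intervals. Both ends
      of the step inspect this angle, and \<open>K m \<le> \<beta> \<le> K (Suc m)\<close>, so the
      increment bound applies on either side of the projection.\<close>
    define \<beta> where "\<beta> = min (\<theta> m + a m) (max (\<theta> (Suc m) - a (Suc m)) \<tau>)"
    have am: "0 \<le> a m" "a m < pi / 2" "0 \<le> a (Suc m)" "a (Suc m) < pi / 2"
      using a[of m] a[of "Suc m"] Suc.prems by auto
    have ivl: "\<theta> m - a m \<le> \<theta> (Suc m) - a (Suc m)" "\<theta> m + a m \<le> \<theta> (Suc m) + a (Suc m)"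
      "\<theta> (Suc m) - a (Suc m) \<le> \<theta> m + a m"
      using lo hi ov Suc.prems by auto
    have "\<beta> - \<theta> m - (K m - \<theta> m) \<le> sin (\<beta> - \<theta> m) / cos (a m) - sin (K m - \<theta> m) / cos (a m)"
      using am ivl by (intro sec_sin_increment_ge) (auto simp: \<beta>_def K_def)
    moreover have "K (Suc m) - \<theta> (Suc m) - (\<beta> - \<theta> (Suc m))
        \<le> sin (K (Suc m) - \<theta> (Suc m)) / cos (a (Suc m)) - sin (\<beta> - \<theta> (Suc m)) / cos (a (Suc m))"
      using am ivl by (intro sec_sin_increment_ge) (auto simp: \<beta>_def K_def)
    moreover have "sin (\<beta> - \<theta> m) / cos (a m) - sin (\<beta> - \<theta> (Suc m)) / cos (a (Suc m))
        \<le> norm (y (Suc m) - y m)"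
      unfolding y_def using chain_step[of "1 / cos (a m)" \<beta> "\<theta> m" "1 / cos (a (Suc m))" "\<theta> (Suc m)"]
      by simp
    moreover have "sqrt 3 - pi / 3 + (K m - (\<theta> 0 - a 0)) - sin (K m - \<theta> m) / cos (a m)
      \<le> norm (y 0) + (\<Sum>i<m. norm (y (Suc i) - y i))"
      using Suc by simp
    ultimately show ?case by simp
  qed
  \<comment> \<open>The total extent of at least \<open>5 * pi / 6\<close> leaves
    \<open>pi / 2\<close> to the right of \<open>\<tau>\<close>, as the end bound requires.\<close>
  have "1 - pi / 2 + (\<theta> n - K n) + a n \<le> sin (\<theta> n - K n) / cos (a n)"
    using a[of n] ext by (intro chain_end) (auto simp: K_def \<tau>_def)
  moreover have "sin (\<theta> n - K n) = - sin (K n - \<theta> n)"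
    by (metis minus_diff_eq sin_minus)
  ultimately show ?thesis
    using main[of n] by simp
qed

section \<open>Arcs on the circle\<close>

text \<open>Shifting \<open>l\<close> into the first period leaves an interval of length at most
  \<open>2 * pi\<close>, which wraps around at most once and thus becomes two intervals of the same
  total length. A measurable superset stands in for \<open>A\<close>, whose measurability then need
  not be shown.\<close>

lemma arc_outer_cover:
  fixes A :: "real set"
  assumes "l \<le> u" "A \<subseteq> {0..<2 * pi}"
    and "\<And>\<phi>. \<phi> \<in> A \<Longrightarrow> \<exists>k::int. l \<le> \<phi> + 2 * pi * k \<and> \<phi> + 2 * pi * k \<le> u"
  shows "\<exists>S\<in>sets lborel. A \<subseteq> S \<and> emeasure lborel S \<le> ennreal (u - l)"
proof (cases "u - l \<le> 2 * pi")
  case False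
  have "emeasure lborel {0..2 * pi} \<le> ennreal (u - l)"
    using False by (simp add: ennreal_leI)
  then show ?thesis using assms(2) by (intro bexI[of _ "{0..2 * pi}"]) auto
next
  case True
  define n where "n = \<lfloor>l / (2 * pi)\<rfloor>"
  define l' where "l' = l - 2 * pi * n"
  define u' where "u' = u - 2 * pi * n"
  have "of_int n \<le> l / (2 * pi)" "l / (2 * pi) < of_int n + 1"
    unfolding n_def by linarith+
  then have "0 \<le> l'" "l' < 2 * pi"
    by (auto simp: l'_def pos_le_divide_eq pos_divide_less_eq algebra_simps)
  moreover have "l' \<le> u'" "u' \<le> l' + 2 * pi" using assms(1) True by (auto simp: l'_def u'_def)
  ultimately have lu: "0 \<le> l'" "l' < 2 * pi" "l' \<le> u'" "u' \<le> l' + 2 * pi" .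
  define S where "S = {l'..min u' (2 * pi)} \<union> {0..u' - 2 * pi}"
  have "A \<subseteq> S"
  proof
    fix \<phi> assume \<phi>: "\<phi> \<in> A"
    then obtain k :: int where k: "l \<le> \<phi> + 2 * pi * k" "\<phi> + 2 * pi * k \<le> u"
      using assms(3) by blast
    have \<phi>': "0 \<le> \<phi>" "\<phi> < 2 * pi" using \<phi> assms(2) by auto
    define m where "m = k - n"
    have m: "l' \<le> \<phi> + 2 * pi * m" "\<phi> + 2 * pi * m \<le> u'"
      using k by (auto simp: m_def l'_def u'_def algebra_simps)
    have "2 * pi * (-1) < 2 * pi * real_of_int m" using m(1) lu(1) \<phi>'(2) by linarith
    then have "-1 < real_of_int m" by (subst (asm) mult_less_cancel_left_pos) auto
    moreover have "2 * pi * real_of_int m < 2 * pi * 2" using m(2) lu \<phi>'(1) by linarith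
    then have "real_of_int m < 2" by (subst (asm) mult_less_cancel_left_pos) auto
    ultimately have "m = 0 \<or> m = 1" by linarith
    then show "\<phi> \<in> S"
      using m \<phi>' lu by (auto simp: S_def)
  qed
  moreover have "emeasure lborel S \<le> ennreal (u - l)"
  proof (cases "u' \<le> 2 * pi")
    case True
    have "emeasure lborel S \<le> emeasure lborel {l'..u'} + emeasure lborel {0..u' - 2 * pi}"
      unfolding S_def using True by (simp only: min_absorb1) (intro emeasure_subadditive, auto)
    also have "\<dots> = ennreal (u - l)"
      using lu True by (cases "u' = 2 * pi") (auto simp: l'_def u'_def)
    finally show ?thesis .
  next
    case False
    have "emeasure lborel S \<le> emeasure lborel {l'..2 * pi} + emeasure lborel {0..u' - 2 * pi}"
      unfolding S_def using False by (simp only: min_absorb2) (intro emeasure_subadditive, auto)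
    also have "\<dots> = ennreal (2 * pi - l' + (u' - 2 * pi))"
      using lu False by (subst ennreal_plus) auto
    also have "\<dots> = ennreal (u - l)"
      by (simp add: l'_def u'_def)
    finally show ?thesis .
  qed
  ultimately show ?thesis by (intro bexI[of _ S]) (auto simp: S_def)
qed

text \<open>Finite subadditivity of Lebesgue measure. The interval is half-open because the arcs are
  taken inside \<open>{0..<2 * pi}\<close>, which for \<open>c = 2 * pi\<close> lacks the right
  end.\<close>

lemma cover_length_le:
  fixes A :: "nat \<Rightarrow> real set"
  assumes "0 \<le> c" "{0..<c} \<subseteq> (\<Union>i\<le>n. A i)"
    and "\<And>i. i \<le> n \<Longrightarrow> \<exists>S\<in>sets lborel. A i \<subseteq> S \<and> emeasure lborel S \<le> ennreal (f i)"
    and "\<And>i. i \<le> n \<Longrightarrow> 0 \<le> f i"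
  shows "c \<le> (\<Sum>i\<le>n. f i)"
proof -
  obtain S where S: "\<And>i. i \<le> n \<Longrightarrow> S i \<in> sets lborel \<and> A i \<subseteq> S i \<and> emeasure lborel (S i) \<le> ennreal (f i)"
    using assms(3) by metis
  have "ennreal c = emeasure lborel {0..<c}" using assms(1) by simp
  also have "\<dots> \<le> emeasure lborel (\<Union>i\<le>n. S i)"
    using assms(2) S by (intro emeasure_mono sets.finite_UN) fastforce+
  also have "\<dots> \<le> (\<Sum>i\<le>n. emeasure lborel (S i))"
    using S by (intro emeasure_subadditive_finite) auto
  also have "\<dots> \<le> (\<Sum>i\<le>n. ennreal (f i))"
    using S by (intro sum_mono) auto
  also have "\<dots> = ennreal (\<Sum>i\<le>n. f i)"
    using assms(4) by (intro sum_ennreal) auto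
  finally show ?thesis
    using assms(4) by (subst (asm) ennreal_le_iff) (auto intro: sum_nonneg)
qed

text \<open>An agent at distance \<open>1 / cos a\<close> from the origin thus inspects exactly the
  arc of half-width \<open>a\<close> around its polar angle.\<close>

lemma sec_cos_ge_1_iff:
  assumes "0 \<le> a" "a < pi / 2" "\<bar>w\<bar> \<le> pi"
  shows "1 \<le> (1 / cos a) * cos w \<longleftrightarrow> \<bar>w\<bar> \<le> a"
proof -
  have "cos a > 0" using assms by (intro cos_gt_zero_pi) auto
  then have "1 \<le> (1 / cos a) * cos w \<longleftrightarrow> cos a \<le> cos \<bar>w\<bar>" by (simp add: field_simps)
  also have "\<dots> \<longleftrightarrow> \<bar>w\<bar> \<le> a" using assms by (intro cos_mono_le_eq) auto
  finally show ?thesis .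
qed

lemma angle_normalize:
  obtains k :: int where "\<bar>x + 2 * pi * k\<bar> \<le> pi"
proof -
  define k where "k = \<lfloor>(pi - x) / (2 * pi)\<rfloor>"
  have "of_int k \<le> (pi - x) / (2 * pi)" "(pi - x) / (2 * pi) < of_int k + 1"
    unfolding k_def by linarith+
  then have "\<bar>x + 2 * pi * k\<bar> \<le> pi"
    by (auto simp: pos_le_divide_eq pos_divide_less_eq algebra_simps abs_le_iff)
  then show ?thesis by (rule that)
qed

lemma cos_plus_2pi_int: "cos (x + 2 * pi * of_int k) = cos x"
  using cos_integer_2pi[of k] sin_integer_2pi[of k] by (simp add: cos_add)

text \<open>\<open>arccos (cos (s - t))\<close> encodes the distance of two angles modulo
  \<open>2 * pi\<close>; \<open>v\<close> is the signed representative realising it.\<close>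

lemma angle_representative:
  obtains v and k :: int where "s - t = v + 2 * pi * k" "\<bar>v\<bar> = arccos (cos (s - t))"
proof -
  obtain k :: int where k: "\<bar>s - t + 2 * pi * k\<bar> \<le> pi" by (rule angle_normalize)
  define v where "v = s - t + 2 * pi * k"
  have "cos (s - t) = cos v" unfolding v_def cos_plus_2pi_int ..
  then have "\<bar>v\<bar> = arccos (cos (s - t))" using k arccos_cos_eq_abs[of v] by (simp add: v_def)
  moreover have "s - t = v + 2 * pi * real_of_int (- k)" by (simp add: v_def)
  ultimately show ?thesis by (intro that)
qed

text \<open>The triangle inequality for angles modulo \<open>2 * pi\<close>:
  \<open>\<bar>v + w\<bar> \<le> (b - a) + a\<close>.\<close>

lemma arc_nested:
  assumes "0 \<le> a" "a < pi / 2" "0 \<le> b" "b < pi / 2"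
    and "arccos (cos (s - t)) \<le> b - a" "1 \<le> (1 / cos a) * cos (t - \<phi>)"
  shows "1 \<le> (1 / cos b) * cos (s - \<phi>)"
proof -
  obtain v and k :: int where v: "s - t = v + 2 * pi * k" "\<bar>v\<bar> = arccos (cos (s - t))"
    by (rule angle_representative)
  obtain m :: int where m: "\<bar>t - \<phi> + 2 * pi * m\<bar> \<le> pi" by (rule angle_normalize)
  define w where "w = t - \<phi> + 2 * pi * m"
  have "cos w = cos (t - \<phi>)" unfolding w_def by (rule cos_plus_2pi_int)
  then have "\<bar>w\<bar> \<le> a"
    using sec_cos_ge_1_iff[of a w] assms m by (simp add: w_def)
  then have vw: "\<bar>v + w\<bar> \<le> b" using v assms(5) by linarith
  have "s - \<phi> = (v + w) + 2 * pi * real_of_int (k - m)"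
    using v by (simp add: w_def algebra_simps)
  then have "cos (s - \<phi>) = cos (v + w)" by (simp only: cos_plus_2pi_int)
  then show ?thesis
    using sec_cos_ge_1_iff[of b "v + w"] assms vw by simp
qed

lemma arc_length_le:
  assumes "0 \<le> a" "a < pi / 2"
  shows "\<exists>S\<in>sets lborel. {\<phi>\<in>{0..<2 * pi}. 1 \<le> (1 / cos a) * cos (t - \<phi>)} \<subseteq> S
    \<and> emeasure lborel S \<le> ennreal (2 * a)"
proof -
  let ?A = "{\<phi>\<in>{0..<2 * pi}. 1 \<le> (1 / cos a) * cos (t - \<phi>)}"
  have "\<exists>k::int. t - a \<le> \<phi> + 2 * pi * k \<and> \<phi> + 2 * pi * k \<le> t + a" if "\<phi> \<in> ?A" for \<phi>
  proof -
    obtain m :: int where m: "\<bar>t - \<phi> + 2 * pi * m\<bar> \<le> pi" by (rule angle_normalize)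
    have "cos (t - \<phi> + 2 * pi * m) = cos (t - \<phi>)" by (rule cos_plus_2pi_int)
    then have "\<bar>t - \<phi> + 2 * pi * m\<bar> \<le> a"
      using sec_cos_ge_1_iff[of a "t - \<phi> + 2 * pi * m"] assms m that by simp
    then show ?thesis by (intro exI[of _ "- m"]) (simp add: abs_le_iff)
  qed
  then have "\<exists>S\<in>sets lborel. ?A \<subseteq> S \<and> emeasure lborel S \<le> ennreal ((t + a) - (t - a))"
    by (intro arc_outer_cover) (use assms in auto)
  moreover have "(t + a) - (t - a) = 2 * a" by simp
  ultimately show ?thesis by (simp only:)
qed

text \<open>Relative to \<open>t\<close>, the new arc reaches from \<open>v - b\<close> to
  \<open>v + b\<close> and the old one from \<open>- a\<close> to \<open>a\<close>. Since
  \<open>\<bar>b - a\<bar> \<le> \<bar>v\<bar>\<close>, the new arc sticks out only on the side of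
  \<open>v\<close>. The minimum with \<open>a + b\<close> covers disjoint arcs, where all of the new
  length \<open>2 * b\<close> counts.\<close>

lemma arc_diff_length_le:
  fixes s t :: real
  defines "d \<equiv> arccos (cos (s - t))"
  assumes "0 \<le> a" "a < pi / 2" "0 \<le> b" "b < pi / 2" "\<bar>b - a\<bar> \<le> d"
  shows "\<exists>S\<in>sets lborel.
    {\<phi>\<in>{0..<2 * pi}. 1 \<le> (1 / cos b) * cos (s - \<phi>) \<and> \<not> 1 \<le> (1 / cos a) * cos (t - \<phi>)} \<subseteq> S
    \<and> emeasure lborel S \<le> ennreal (min d (a + b) + b - a)"
proof -
  let ?A = "{\<phi>\<in>{0..<2 * pi}. 1 \<le> (1 / cos b) * cos (s - \<phi>) \<and> \<not> 1 \<le> (1 / cos a) * cos (t - \<phi>)}"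
  obtain v and k :: int where v: "s - t = v + 2 * pi * k" "\<bar>v\<bar> = d"
    unfolding d_def by (rule angle_representative)
  define l where "l = (if 0 \<le> v then max (v - b) a else v - b)"
  define u where "u = (if 0 \<le> v then v + b else min (v + b) (- a))"
  have lu: "l \<le> u" "u - l = min d (a + b) + b - a"
    using v assms(2-) by (auto simp: l_def u_def)
  have "\<exists>k::int. t + l \<le> \<phi> + 2 * pi * k \<and> \<phi> + 2 * pi * k \<le> t + u" if \<phi>: "\<phi> \<in> ?A" for \<phi>
  proof -
    obtain m :: int where m: "\<bar>s - \<phi> + 2 * pi * m\<bar> \<le> pi" by (rule angle_normalize)
    define w where "w = s - \<phi> + 2 * pi * m"
    have "cos w = cos (s - \<phi>)" unfolding w_def by (rule cos_plus_2pi_int)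
    then have w: "\<bar>w\<bar> \<le> b"
      using sec_cos_ge_1_iff[of b w] assms(2-) m \<phi> by (simp add: w_def)
    have "t - \<phi> = (w - v) + 2 * pi * real_of_int (- m - k)"
      using v by (simp add: w_def algebra_simps)
    then have "cos (t - \<phi>) = cos (w - v)" by (simp only: cos_plus_2pi_int)
    then have "\<not> \<bar>w - v\<bar> \<le> a"
      using sec_cos_ge_1_iff[of a "w - v"] assms(2-) \<phi> by auto
    then have "l \<le> v - w" "v - w \<le> u"
      using w v assms(2-) by (auto simp: l_def u_def)
    moreover have "\<phi> + 2 * pi * real_of_int (- m - k) = t + (v - w)"
      using v by (simp add: w_def algebra_simps)
    ultimately show ?thesis by (intro exI[of _ "- m - k"]) simp
  qed
  then have "\<exists>S\<in>sets lborel. ?A \<subseteq> S \<and> emeasure lborel S \<le> ennreal ((t + u) - (t + l))"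
    by (intro arc_outer_cover) (use lu in auto)
  moreover have "(t + u) - (t + l) = min d (a + b) + b - a" using lu by simp
  ultimately show ?thesis by (simp only:)
qed

text \<open>By the law of cosines, for fixed distances from the origin the distance of two points is
  a decreasing function of the cosine of the angle between them.\<close>

lemma norm_diff_circle_pt_mono:
  assumes "0 \<le> r" "0 \<le> r'" "cos (t' - t) \<le> cos (s' - s)"
  shows "norm (r' *\<^sub>R circle_pt s' - r *\<^sub>R circle_pt s) \<le> norm (r' *\<^sub>R circle_pt t' - r *\<^sub>R circle_pt t)"
proof -
  have *: "(norm (r' *\<^sub>R circle_pt v - r *\<^sub>R circle_pt u))\<^sup>2 = r'\<^sup>2 + r\<^sup>2 - 2 * (r * r') * cos (v - u)" for u v
    unfolding power2_norm_eq_inner inner_diff_left inner_diff_right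
    by (simp add: cos_diff power2_eq_square algebra_simps)
  have "(r * r') * cos (t' - t) \<le> (r * r') * cos (s' - s)"
    using assms by (intro mult_left_mono) auto
  then show ?thesis
    by (intro power2_le_imp_le[OF _ norm_ge_zero]) (simp add: *)
qed

text \<open>
  Since neither of two consecutive arcs contains the other, each step adds to the inspected set at
  most the angle between the two positions (cut off at \<open>e i\<close>) plus the change of the half-width;
  these bounds telescope to the total extent of the unrolled chain.
\<close>

lemma irredundant_cover_bound:
  fixes x :: "nat \<Rightarrow> real^2"
  assumes c: "5 * pi / 6 \<le> c" "c \<le> 2 * pi"
    and cover: "\<And>\<phi>. \<phi> \<in> {0..c} \<Longrightarrow> \<exists>i\<le>n. 1 \<le> x i \<bullet> circle_pt \<phi>"
    and useful: "\<And>i. i \<le> n \<Longrightarrow> \<exists>\<phi>. 1 \<le> x i \<bullet> circle_pt \<phi>"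
    and irr: "\<And>i j. i \<le> n \<Longrightarrow> j \<le> n \<Longrightarrow> i \<noteq> j \<Longrightarrow>
      \<exists>\<phi>. 1 \<le> x i \<bullet> circle_pt \<phi> \<and> \<not> 1 \<le> x j \<bullet> circle_pt \<phi>"
  shows "1 + sqrt 3 + c - 5 * pi / 6 \<le> norm (x 0) + (\<Sum>i<n. norm (x (Suc i) - x i))"
proof -
  have "\<forall>i. \<exists>t. x i = norm (x i) *\<^sub>R circle_pt t" using real2_polar by metis
  then obtain t where t: "\<And>i. x i = norm (x i) *\<^sub>R circle_pt (t i)" by metis
  have ge1: "norm (x i) \<ge> 1" if "i \<le> n" for i
  proof -
    obtain \<phi> where "1 \<le> x i \<bullet> circle_pt \<phi>" using useful \<open>i \<le> n\<close> by blast
    then show ?thesis using norm_cauchy_schwarz[of "x i" "circle_pt \<phi>"] by simp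
  qed
  have inv: "0 < 1 / norm (x i)" "1 / norm (x i) \<le> 1" if "i \<le> n" for i
  proof -
    have "norm (x i) > 0" using ge1[OF that] by linarith
    then show "0 < 1 / norm (x i)" "1 / norm (x i) \<le> 1" using ge1[OF that] by auto
  qed
  define a where "a i = arccos (1 / norm (x i))" for i
  have cosa: "1 / cos (a i) = norm (x i)" if "i \<le> n" for i
  proof -
    have "cos (a i) = 1 / norm (x i)" unfolding a_def using inv[OF that] by (intro cos_arccos) linarith+
    then show ?thesis by simp
  qed
  have a: "0 \<le> a i" "a i < pi / 2" if "i \<le> n" for i
  proof -
    have "- 1 \<le> 1 / norm (x i)" using inv(1)[OF that] by linarith
    from arccos_lbound[OF this] show "0 \<le> a i" "a i < pi / 2"
      using inv[OF that] arccos_less_mono[of "1 / norm (x i)" 0]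
      unfolding a_def by auto
  qed
  have xin: "x i \<bullet> circle_pt \<phi> = (1 / cos (a i)) * cos (t i - \<phi>)" if "i \<le> n" for i \<phi>
    unfolding cosa[OF that] by (subst t) simp
  define d where "d i = arccos (cos (t (Suc i) - t i))" for i
  have d: "0 \<le> d i" "d i \<le> pi" "cos (d i) = cos (t (Suc i) - t i)" for i
    by (auto simp: d_def arccos_lbound arccos_ubound)
  have d_sym: "arccos (cos (t i - t (Suc i))) = d i" for i
    unfolding d_def using cos_minus[of "t i - t (Suc i)"] by simp
  \<comment> \<open>Otherwise one of the two arcs would contain the other, against
    irredundancy.\<close>
  have nonnested: "\<bar>a (Suc i) - a i\<bar> \<le> d i" if i: "i < n" for i
  proof (rule ccontr)
    have le: "i \<le> n" "Suc i \<le> n" using i by auto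
    assume "\<not> ?thesis"
    then consider "d i \<le> a (Suc i) - a i" | "d i \<le> a i - a (Suc i)" by linarith
    then show False
    proof cases
      case 1
      then show False
        using irr[of i "Suc i"] le arc_nested[of "a i" "a (Suc i)" "t (Suc i)" "t i"] a[OF le(1)] a[OF le(2)]
        by (auto simp: xin d_def)
    next
      case 2
      then show False
        using irr[of "Suc i" i] le arc_nested[of "a (Suc i)" "a i" "t i" "t (Suc i)"] a[OF le(1)] a[OF le(2)]
        by (auto simp: xin d_sym)
    qed
  qed
  \<comment> \<open>At the angle \<open>a i + a (Suc i)\<close> the two unrolled arcs just touch; a
    larger one would open a gap in the chain.\<close>
  define e where "e i = min (d i) (a i + a (Suc i))" for i
  have e: "\<bar>a (Suc i) - a i\<bar> \<le> e i" "e i \<le> a i + a (Suc i)" "0 \<le> e i" if "i < n" for i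
    using nonnested[OF that] a[of i] a[of "Suc i"] d(1)[of i] that by (auto simp: e_def)
  define \<theta> where "\<theta> i = (\<Sum>j<i. e j)" for i
  have \<theta>_Suc: "\<theta> (Suc i) = \<theta> i + e i" for i by (simp add: \<theta>_def)

  define f where "f i = (case i of 0 \<Rightarrow> 2 * a 0 | Suc j \<Rightarrow> e j + a (Suc j) - a j)" for i
  \<comment> \<open>Only the arc of the immediate predecessor is removed. These sets still cover, as
    each angle lies in the set of the first index that inspects it.\<close>
  define A where "A i = (case i of 0 \<Rightarrow> {\<phi>\<in>{0..<2 * pi}. 1 \<le> x 0 \<bullet> circle_pt \<phi>}
    | Suc j \<Rightarrow> {\<phi>\<in>{0..<2 * pi}. 1 \<le> x (Suc j) \<bullet> circle_pt \<phi> \<and> \<not> 1 \<le> x j \<bullet> circle_pt \<phi>})" for i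
  have "c \<le> (\<Sum>i\<le>n. f i)"
  proof (rule cover_length_le)
    show "0 \<le> c" using c(1) pi_gt_zero by linarith
    show "{0..<c} \<subseteq> (\<Union>i\<le>n. A i)"
    proof
      fix \<phi> assume \<phi>: "\<phi> \<in> {0..<c}"
      define i where "i = (LEAST i. i \<le> n \<and> 1 \<le> x i \<bullet> circle_pt \<phi>)"
      have "\<exists>i. i \<le> n \<and> 1 \<le> x i \<bullet> circle_pt \<phi>" using cover[of \<phi>] \<phi> by auto
      then have i: "i \<le> n" "1 \<le> x i \<bullet> circle_pt \<phi>"
        unfolding i_def by (metis (mono_tags, lifting) LeastI)+
      have "\<not> 1 \<le> x j \<bullet> circle_pt \<phi>" if "j < i" for j
        using not_less_Least[of j "\<lambda>i. i \<le> n \<and> 1 \<le> x i \<bullet> circle_pt \<phi>"] that i(1)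
        unfolding i_def[symmetric] by auto
      then have "\<phi> \<in> A i" using i \<phi> c by (cases i) (auto simp: A_def)
      then show "\<phi> \<in> (\<Union>i\<le>n. A i)" using i by auto
    qed
  next
    fix i assume i: "i \<le> n"
    show "\<exists>S\<in>sets lborel. A i \<subseteq> S \<and> emeasure lborel S \<le> ennreal (f i)"
    proof (cases i)
      case 0
      then show ?thesis using arc_length_le[OF a[of 0], of "t 0"] by (simp add: A_def f_def xin)
    next
      case (Suc j)
      then show ?thesis
        using arc_diff_length_le[of "a j" "a (Suc j)" "t (Suc j)" "t j"] a[of j] a[of "Suc j"]
          nonnested[of j] i
        by (simp add: A_def f_def xin e_def d_def)
    qed
    show "0 \<le> f i"
      using i a[of 0] e[of "i - 1"] by (cases i) (auto simp: f_def abs_le_iff)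
  qed
  also have "(\<Sum>i\<le>n. f i) = 2 * a 0 + (\<Sum>i<n. e i + (a (Suc i) - a i))"
    by (subst sum.atMost_shift) (simp add: f_def algebra_simps)
  also have "\<dots> = (\<theta> n + a n) - (\<theta> 0 - a 0)"
    by (simp add: sum.distrib sum_lessThan_telescope \<theta>_def)
  finally have ext: "c \<le> (\<theta> n + a n) - (\<theta> 0 - a 0)" .

  define y where "y i = (1 / cos (a i)) *\<^sub>R circle_pt (\<theta> i)" for i
  have "1 + sqrt 3 - 5 * pi / 6 + (\<theta> n + a n) - (\<theta> 0 - a 0)
      \<le> norm (y 0) + (\<Sum>i<n. norm (y (Suc i) - y i))"
    unfolding y_def
  proof (rule chain_bound)
    fix i assume i: "i < n"
    show "\<theta> i - a i \<le> \<theta> (Suc i) - a (Suc i)" "\<theta> i + a i \<le> \<theta> (Suc i) + a (Suc i)"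
      "\<theta> (Suc i) - a (Suc i) \<le> \<theta> i + a i"
      using e[OF i] by (auto simp: \<theta>_Suc abs_le_iff)
  qed (use a ext c in auto)
  also have "norm (y 0) = norm (x 0)" using cosa[of 0] by (simp add: y_def)
  also have "(\<Sum>i<n. norm (y (Suc i) - y i)) \<le> (\<Sum>i<n. norm (x (Suc i) - x i))"
  proof (rule sum_mono)
    fix i assume "i \<in> {..<n}"
    then have i: "i < n" "i \<le> n" "Suc i \<le> n" by auto
    have "cos (d i) \<le> cos (e i)"
      using e[OF i(1)] d(2)[of i] by (intro cos_monotone_0_pi_le) (auto simp: e_def)
    then have "cos (t (Suc i) - t i) \<le> cos (\<theta> (Suc i) - \<theta> i)"
      by (simp add: d \<theta>_Suc)
    then have "norm (y (Suc i) - y i)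
        \<le> norm (norm (x (Suc i)) *\<^sub>R circle_pt (t (Suc i)) - norm (x i) *\<^sub>R circle_pt (t i))"
      unfolding y_def cosa[OF i(2)] cosa[OF i(3)] by (intro norm_diff_circle_pt_mono) auto
    then show "norm (y (Suc i) - y i) \<le> norm (x (Suc i) - x i)"
      by (simp only: t[symmetric])
  qed
  finally show ?thesis using ext by simp
qed

section \<open>Lower bounds for trajectories\<close>

text \<open>Lowering the inspection threshold from 1 to \<open>z < 1\<close> makes the inspected
  sets open, so by compactness finitely many times suffice. A cover with the fewest times is
  irredundant; sorting its times gives the sequence to which the discrete bound applies. Letting
  \<open>z\<close> tend to 1 recovers the claim.\<close>

lemma arc_lower_bound:
  assumes \<gamma>: "trajectory \<gamma>" and c: "5 * pi / 6 \<le> c" "c \<le> 2 * pi" and "0 \<le> T"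
    and ins: "\<And>\<phi>. \<phi> \<in> {0..c} \<Longrightarrow> \<exists>s. 0 \<le> s \<and> s \<le> T \<and> 1 \<le> \<gamma> s \<bullet> circle_pt \<phi>"
  shows "1 + sqrt 3 + c - 5 * pi / 6 \<le> T"
proof (rule field_le_mult_one_interval)
  fix z :: real assume z: "0 < z" "z < 1"
  have "\<forall>\<phi>\<in>{0..c}. \<exists>s. 0 \<le> s \<and> s \<le> T \<and> 1 \<le> \<gamma> s \<bullet> circle_pt \<phi>" using ins by blast
  then obtain \<sigma> where \<sigma>: "\<And>\<phi>. \<phi> \<in> {0..c} \<Longrightarrow> 0 \<le> \<sigma> \<phi> \<and> \<sigma> \<phi> \<le> T \<and> 1 \<le> \<gamma> (\<sigma> \<phi>) \<bullet> circle_pt \<phi>"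
    by metis
  have cont: "continuous_on UNIV (\<lambda>\<psi>. A \<bullet> circle_pt \<psi>)" for A
    unfolding circle_pt_def inner_vec_def sum_2 vector_2 by (intro continuous_intros)
  have "open {\<psi>. z < \<gamma> (\<sigma> \<phi>) \<bullet> circle_pt \<psi>}" for \<phi>
    by (intro open_Collect_less continuous_on_const cont)
  moreover have "{0..c} \<subseteq> (\<Union>\<phi>\<in>{0..c}. {\<psi>. z < \<gamma> (\<sigma> \<phi>) \<bullet> circle_pt \<psi>})"
    using \<sigma> z by fastforce
  ultimately obtain C where C: "C \<subseteq> {0..c}" "finite C"
      "{0..c} \<subseteq> (\<Union>\<phi>\<in>C. {\<psi>. z < \<gamma> (\<sigma> \<phi>) \<bullet> circle_pt \<psi>})"
    by (rule compactE_image[OF compact_Icc])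
  \<comment> \<open>Scaling positions by \<open>1 / z\<close> turns the threshold \<open>z\<close>
    back into 1, at the price of a factor \<open>1 / z\<close> in all distances.\<close>
  define hits where "hits s \<phi> \<longleftrightarrow> 1 \<le> ((1 / z) *\<^sub>R \<gamma> s) \<bullet> circle_pt \<phi>" for s \<phi>
  define covers where "covers F \<longleftrightarrow> finite F \<and> F \<subseteq> {0..T} \<and> (\<forall>\<phi>\<in>{0..c}. \<exists>s\<in>F. hits s \<phi>)" for F
  have "covers (\<sigma> ` C)"
    unfolding covers_def
  proof (intro conjI ballI)
    fix \<phi> assume "\<phi> \<in> {0..c}"
    then obtain \<psi> where "\<psi> \<in> C" "z < \<gamma> (\<sigma> \<psi>) \<bullet> circle_pt \<phi>" using C(3) by blast
    then show "\<exists>s\<in>\<sigma> ` C. hits s \<phi>"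
      using z by (intro bexI[of _ "\<sigma> \<psi>"]) (auto simp: hits_def)
  qed (use C \<sigma> in auto)
  then obtain F where F: "covers F" and least: "\<And>G. covers G \<Longrightarrow> card F \<le> card G"
    using ex_has_least_nat[of covers _ card] by metis
  have irr: "\<exists>\<phi>. hits s \<phi> \<and> \<not> hits s' \<phi>" if "s \<in> F" "s' \<in> F" "s \<noteq> s'" for s s'
  proof (rule ccontr)
    assume "\<not> ?thesis"
    then have "covers (F - {s})"
      using F that unfolding covers_def by blast
    from least[OF this] show False
      using F \<open>s \<in> F\<close> card_Diff1_less[of F s] by (simp add: covers_def)
  qed
  have "0 \<le> c" using c(1) pi_gt_zero by linarith
  then have "0 \<in> {0..c}" by simp
  then obtain s0 where "s0 \<in> F" "hits s0 0" using F unfolding covers_def by blast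
  \<comment> \<open>Some \<open>s0\<close> inspects the angle 0; any other time in \<open>F\<close>
    inspects an angle that \<open>s0\<close> misses.\<close>
  have useful: "\<exists>\<phi>. hits s \<phi>" if "s \<in> F" for s
    using irr[OF that \<open>s0 \<in> F\<close>] \<open>hits s0 0\<close> by (cases "s = s0") auto
  define ts where "ts = sorted_list_of_set F"
  define n where "n = card F - 1"
  have finF: "finite F" using F by (simp add: covers_def)
  have "card F > 0" using finF \<open>s0 \<in> F\<close> by (auto simp: card_gt_0_iff)
  then have len: "length ts = Suc n" by (simp add: ts_def n_def)
  have set_ts: "set ts = F" using finF by (simp add: ts_def)
  have dist: "distinct ts" and srt: "sorted ts" by (simp_all add: ts_def)
  have in_F: "ts ! i \<in> F" if "i \<le> n" for i
    using that len set_ts nth_mem[of i ts] by auto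
  have ts_bounds: "0 \<le> ts ! i" "ts ! i \<le> T" if "i \<le> n" for i
    using in_F[OF that] F by (auto simp: covers_def)
  define x where "x i = (1 / z) *\<^sub>R \<gamma> (ts ! i)" for i
  have hits_x: "hits (ts ! i) \<phi> \<longleftrightarrow> 1 \<le> x i \<bullet> circle_pt \<phi>" for i \<phi>
    by (simp add: hits_def x_def)
  have "1 + sqrt 3 + c - 5 * pi / 6 \<le> norm (x 0) + (\<Sum>i<n. norm (x (Suc i) - x i))"
  proof (rule irredundant_cover_bound[OF c])
    fix \<phi> assume "\<phi> \<in> {0..c}"
    then obtain s where "s \<in> F" "hits s \<phi>" using F unfolding covers_def by blast
    then obtain i where "i < length ts" "ts ! i = s" using set_ts by (metis in_set_conv_nth)
    then show "\<exists>i\<le>n. 1 \<le> x i \<bullet> circle_pt \<phi>"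
      using \<open>hits s \<phi>\<close> len hits_x by (intro exI[of _ i]) auto
  next
    fix i j :: nat assume "i \<le> n" "j \<le> n" "i \<noteq> j"
    then have "ts ! i \<noteq> ts ! j" using dist len by (simp add: nth_eq_iff_index_eq)
    then show "\<exists>\<phi>. 1 \<le> x i \<bullet> circle_pt \<phi> \<and> \<not> 1 \<le> x j \<bullet> circle_pt \<phi>"
      using irr[of "ts ! i" "ts ! j"] in_F \<open>i \<le> n\<close> \<open>j \<le> n\<close> hits_x by auto
  next
    fix i assume "i \<le> n"
    then show "\<exists>\<phi>. 1 \<le> x i \<bullet> circle_pt \<phi>" using useful in_F hits_x by blast
  qed
  also have "\<dots> \<le> (1 / z) * (ts ! 0) + (\<Sum>i<n. (1 / z) * (ts ! Suc i - ts ! i))"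
  proof (intro add_mono sum_mono)
    have "norm (\<gamma> (ts ! 0) - \<gamma> 0) \<le> \<bar>ts ! 0 - 0\<bar>"
      using \<gamma> ts_bounds(1)[of 0] unfolding trajectory_def by blast
    then have "norm (\<gamma> (ts ! 0)) \<le> ts ! 0"
      using \<gamma> ts_bounds(1)[of 0] by (simp add: trajectory_def)
    then show "norm (x 0) \<le> (1 / z) * (ts ! 0)"
      using z by (simp add: x_def divide_right_mono)
    fix i assume "i \<in> {..<n}"
    then have i: "i \<le> n" "Suc i \<le> n" by auto
    have "ts ! i \<le> ts ! Suc i" using srt len i by (intro sorted_nth_mono) auto
    then have "norm (\<gamma> (ts ! Suc i) - \<gamma> (ts ! i)) \<le> ts ! Suc i - ts ! i"
      using \<gamma> ts_bounds(1)[OF i(1)] ts_bounds(1)[OF i(2)] unfolding trajectory_def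
      by (metis abs_of_nonneg diff_ge_0_iff_ge)
    then have "(1 / z) * norm (\<gamma> (ts ! Suc i) - \<gamma> (ts ! i)) \<le> (1 / z) * (ts ! Suc i - ts ! i)"
      using z by (intro mult_left_mono) auto
    moreover have "norm (x (Suc i) - x i) = (1 / z) * norm (\<gamma> (ts ! Suc i) - \<gamma> (ts ! i))"
      using z by (simp add: x_def flip: scaleR_diff_right)
    ultimately show "norm (x (Suc i) - x i) \<le> (1 / z) * (ts ! Suc i - ts ! i)" by simp
  qed
  also have "\<dots> = (1 / z) * (ts ! n)"
    unfolding sum_distrib_left[symmetric] sum_lessThan_telescope by (simp add: diff_divide_distrib)
  also have "\<dots> \<le> (1 / z) * T"
    using ts_bounds(2)[of n] z by (intro mult_left_mono) auto
  finally show "z * (1 + sqrt 3 + c - 5 * pi / 6) \<le> T"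
    using z by (simp add: pos_le_divide_eq mult.commute)
qed

lemma trajectory_two_points:
  assumes "trajectory \<gamma>" "0 \<le> s" "s \<le> t" "t \<le> T"
  shows "norm (\<gamma> s) + norm (\<gamma> t - \<gamma> s) \<le> T"
proof -
  have "0 \<le> t" using assms by linarith
  then have "norm (\<gamma> s - \<gamma> 0) \<le> \<bar>s - 0\<bar>" "norm (\<gamma> t - \<gamma> s) \<le> \<bar>t - s\<bar>" "\<gamma> 0 = 0"
    using assms(1,2) unfolding trajectory_def by blast+
  then show ?thesis using assms by simp
qed

definition inspection_value :: "real \<Rightarrow> real" where
  "inspection_value c = (if c \<le> 2 * pi / 3 then 1 / cos (c / 2)
     else if c \<le> 5 * pi / 6 then 1 - 2 * cos c
     else 1 + sqrt 3 + c - 5 * pi / 6)"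

text \<open>The two ends of the arc may be inspected in either order, so the two-tangent bounds are
  applied with the ends exchanged as well.\<close>

lemma inspection_value_le:
  assumes \<gamma>: "trajectory \<gamma>" and c: "0 \<le> c" "c \<le> 2 * pi" and T: "0 \<le> T"
    and ins: "\<And>\<phi>. \<phi> \<in> {0..c} \<Longrightarrow> \<exists>s. 0 \<le> s \<and> s \<le> T \<and> 1 \<le> \<gamma> s \<bullet> circle_pt \<phi>"
  shows "inspection_value c \<le> T"
proof -
  obtain s where s: "0 \<le> s" "s \<le> T" "1 \<le> \<gamma> s \<bullet> circle_pt 0" using ins[of 0] c by auto
  obtain t where t: "0 \<le> t" "t \<le> T" "1 \<le> \<gamma> t \<bullet> circle_pt c" using ins[of c] c by auto
  have E: "circle_pt 0 \<bullet> circle_pt c = cos c" "circle_pt c \<bullet> circle_pt 0 = cos c" by simp_all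
  consider "c \<le> 2 * pi / 3" | "2 * pi / 3 < c" "c \<le> 5 * pi / 6" | "\<not> c \<le> 2 * pi / 3" "5 * pi / 6 < c" by linarith
  then show ?thesis
  proof cases
    case 1
    have "1 / cos (c / 2) \<le> T"
    proof (cases "s \<le> t")
      case True
      have "1 / cos (c / 2) \<le> norm (\<gamma> s) + norm (\<gamma> t - \<gamma> s)"
        using two_points_bound_corner[OF _ _ E(1)] c 1 s t by simp
      then show ?thesis using trajectory_two_points[OF \<gamma> s(1) True t(2)] by linarith
    next
      case False
      have "1 / cos (c / 2) \<le> norm (\<gamma> t) + norm (\<gamma> s - \<gamma> t)"
        using two_points_bound_corner[OF _ _ E(2)] c 1 s t by simp
      then show ?thesis using trajectory_two_points[OF \<gamma> t(1) _ s(2)] False by linarith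
    qed
    then show ?thesis using 1 by (simp add: inspection_value_def)
  next
    case 2
    have "cos c \<le> cos (pi / 2)" using 2 by (intro cos_monotone_0_pi_le) auto
    then have neg: "cos c \<le> 0" by simp
    have "1 - 2 * cos c \<le> T"
    proof (cases "s \<le> t")
      case True
      have "1 - 2 * cos c \<le> norm (\<gamma> s) + norm (\<gamma> t - \<gamma> s)"
        using two_points_bound_reflect[OF _ _ E(1) neg] s t by simp
      then show ?thesis using trajectory_two_points[OF \<gamma> s(1) True t(2)] by linarith
    next
      case False
      have "1 - 2 * cos c \<le> norm (\<gamma> t) + norm (\<gamma> s - \<gamma> t)"
        using two_points_bound_reflect[OF _ _ E(2) neg] s t by simp
      then show ?thesis using trajectory_two_points[OF \<gamma> t(1) _ s(2)] False by linarith
    qed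
    then show ?thesis using 2 by (simp add: inspection_value_def)
  next
    case 3
    then show ?thesis
      using arc_lower_bound[OF \<gamma> _ c(2) T ins] by (simp add: inspection_value_def)
  qed
qed

section \<open>Optimal trajectories\<close>

text \<open>The Lipschitz condition of \<open>trajectory\<close> restricted to a set of times, so
  that a path can be assembled from legs.\<close>

definition unit_speed_on :: "real set \<Rightarrow> (real \<Rightarrow> real^2) \<Rightarrow> bool" where
  "unit_speed_on S f \<longleftrightarrow> (\<forall>s\<in>S. \<forall>t\<in>S. norm (f s - f t) \<le> \<bar>s - t\<bar>)"

lemma unit_speed_on_join:
  assumes f: "unit_speed_on {a..b} f" and g: "unit_speed_on {b..} g" and "a \<le> b" "f b = g b"
  shows "unit_speed_on {a..} (\<lambda>s. if s \<le> b then f s else g s)"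
proof -
  let ?h = "\<lambda>s. if s \<le> b then f s else g s"
  have le: "norm (?h s - ?h t) \<le> \<bar>s - t\<bar>" if "a \<le> s" "s \<le> t" for s t
  proof (cases "s \<le> b \<and> b < t")
    case True
    have "norm (f s - g t) \<le> norm (f s - f b) + norm (g b - g t)"
      using norm_triangle_ineq[of "f s - f b" "g b - g t"] \<open>f b = g b\<close> by simp
    also have "norm (f s - f b) \<le> \<bar>s - b\<bar>"
      using f[unfolded unit_speed_on_def, rule_format, of s b] True that by simp
    also have "norm (g b - g t) \<le> \<bar>b - t\<bar>"
      using g[unfolded unit_speed_on_def, rule_format, of b t] True by simp
    finally show ?thesis using True by simp
  next
    case False
    then show ?thesis
      using f[unfolded unit_speed_on_def, rule_format, of s t]
        g[unfolded unit_speed_on_def, rule_format, of s t] that by auto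
  qed
  show ?thesis
    unfolding unit_speed_on_def
  proof (intro ballI)
    fix s t assume "s \<in> {a..}" "t \<in> {a..}"
    then show "norm (?h s - ?h t) \<le> \<bar>s - t\<bar>"
      using le[of s t] le[of t s] norm_minus_commute[of "?h s" "?h t"]
      by (cases "s \<le> t") (simp_all only: atLeast_iff abs_minus_commute)
  qed
qed

lemma unit_speed_on_line: "unit_speed_on S (\<lambda>s. p + (s - r) *\<^sub>R circle_pt t)"
proof -
  have "p + (s - r) *\<^sub>R circle_pt t - (p + (s' - r) *\<^sub>R circle_pt t) = (s - s') *\<^sub>R circle_pt t" for s s'
    by (simp add: algebra_simps)
  then show ?thesis by (simp add: unit_speed_on_def)
qed

lemma unit_speed_on_ray: "unit_speed_on S (\<lambda>s. s *\<^sub>R circle_pt t)"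
  using unit_speed_on_line[of S 0 0 t] by simp

text \<open>A chord of the unit circle, \<open>2 * \<bar>sin ((s - t) / 2)\<bar>\<close>, is at most
  as long as its arc.\<close>

lemma unit_speed_on_circle: "unit_speed_on S (\<lambda>s. circle_pt (s + r))"
proof -
  have "norm (circle_pt (s + r) - circle_pt (t + r)) \<le> \<bar>s - t\<bar>" for s t
  proof -
    have half: "2 * ((s - t) / 2) = s - t" by simp
    have "(norm (circle_pt (s + r) - circle_pt (t + r)))\<^sup>2 = 2 - 2 * cos (s - t)"
      by (simp add: power2_norm_eq_inner inner_diff_left inner_diff_right cos_minus[of "s - t", symmetric])
    also have "\<dots> = (2 * \<bar>sin ((s - t) / 2)\<bar>)\<^sup>2"
      using cos_double_sin[of "(s - t) / 2", unfolded half] by (simp add: power_mult_distrib)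
    finally have "norm (circle_pt (s + r) - circle_pt (t + r)) = 2 * \<bar>sin ((s - t) / 2)\<bar>"
      by (subst (asm) power2_eq_iff_nonneg) auto
    then show ?thesis using abs_sin_x_le_abs_x[of "(s - t) / 2"] by simp
  qed
  then show ?thesis by (simp add: unit_speed_on_def)
qed

lemma trajectoryI:
  assumes "unit_speed_on {0..} \<gamma>" "\<gamma> 0 = 0"
  shows "trajectory \<gamma>"
proof -
  have "1-lipschitz_on {0..} \<gamma>"
    using assms(1) by (intro lipschitz_onI) (auto simp: unit_speed_on_def dist_norm)
  then show ?thesis
    using assms by (auto simp: trajectory_def unit_speed_on_def intro: lipschitz_on_continuous_on)
qed

text \<open>The vector \<open>circle_pt \<phi>\<close> is a nonnegative combination of the two end
  vectors, with weights \<open>p\<close> and \<open>q\<close> divided by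
  \<open>sin (\<beta> - \<alpha>)\<close> whose sum is at least 1. Inspecting the ends of a short
  arc therefore means inspecting all of it.\<close>

lemma inner_circle_pt_between:
  assumes "1 \<le> x \<bullet> circle_pt \<alpha>" "1 \<le> x \<bullet> circle_pt \<beta>" "\<alpha> \<le> \<phi>" "\<phi> \<le> \<beta>" "\<beta> - \<alpha> < pi"
  shows "1 \<le> x \<bullet> circle_pt \<phi>"
proof (cases "\<alpha> = \<beta>")
  case False
  define p q where "p = sin (\<beta> - \<phi>)" and "q = sin (\<phi> - \<alpha>)"
  have S: "sin (\<beta> - \<alpha>) > 0" using assms False by (intro sin_gt_zero) auto
  have pq: "p \<ge> 0" "q \<ge> 0" using assms by (auto simp: p_def q_def intro!: sin_ge_zero)
  have "sin (\<beta> - \<alpha>) = p * cos (\<phi> - \<alpha>) + cos (\<beta> - \<phi>) * q"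
    using sin_add[of "\<beta> - \<phi>" "\<phi> - \<alpha>"] by (simp add: p_def q_def)
  also have "\<dots> \<le> p * 1 + 1 * q"
    using pq by (intro add_mono mult_left_mono mult_right_mono) auto
  finally have sum: "sin (\<beta> - \<alpha>) \<le> p + q" by simp
  have "p * sin \<alpha> + q * sin \<beta> = sin (\<beta> - \<alpha>) * sin \<phi>"
    by (simp add: p_def q_def sin_diff algebra_simps)
  moreover have "p * cos \<alpha> + q * cos \<beta> = sin (\<beta> - \<alpha>) * cos \<phi>"
    by (simp add: p_def q_def sin_diff algebra_simps)
  ultimately have "sin (\<beta> - \<alpha>) *\<^sub>R circle_pt \<phi> = p *\<^sub>R circle_pt \<alpha> + q *\<^sub>R circle_pt \<beta>"
    by (subst vec_eq_iff) (simp add: forall_2 circle_pt_def)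
  then have "sin (\<beta> - \<alpha>) * (x \<bullet> circle_pt \<phi>) = p * (x \<bullet> circle_pt \<alpha>) + q * (x \<bullet> circle_pt \<beta>)"
    by (metis inner_add_right inner_scaleR_right)
  also have "\<dots> \<ge> p * 1 + q * 1"
    using assms pq by (intro add_mono mult_left_mono) auto
  finally have "sin (\<beta> - \<alpha>) * 1 \<le> sin (\<beta> - \<alpha>) * (x \<bullet> circle_pt \<phi>)"
    using sum by simp
  then show ?thesis using S by (subst (asm) mult_le_cancel_left_pos) auto
qed (use assms in auto)

text \<open>The agent walks along the bisector to the intersection of the tangents at the two
  ends.\<close>

lemma optimal_trajectory_ray:
  assumes "0 \<le> c" "c \<le> 2 * pi / 3"
  shows "\<exists>\<gamma>. trajectory \<gamma> \<and>
    (\<forall>\<phi>\<in>{0..c}. \<exists>s. 0 \<le> s \<and> s \<le> 1 / cos (c / 2) \<and> 1 \<le> \<gamma> s \<bullet> circle_pt \<phi>)"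
proof -
  define \<gamma> where "\<gamma> = (\<lambda>s. s *\<^sub>R circle_pt (c / 2))"
  have "trajectory \<gamma>"
    unfolding \<gamma>_def by (intro trajectoryI unit_speed_on_ray) simp
  moreover have "1 \<le> \<gamma> (1 / cos (c / 2)) \<bullet> circle_pt \<phi>" if "\<phi> \<in> {0..c}" for \<phi>
  proof -
    have "0 < pi" "c / 2 < pi / 2" using assms(2) pi_gt_zero by linarith+
    moreover have "\<bar>c / 2 - \<phi>\<bar> \<le> c / 2" using that unfolding abs_le_iff by auto
    ultimately show ?thesis
      using sec_cos_ge_1_iff[of "c / 2" "c / 2 - \<phi>"] assms pi_gt_zero by (simp add: \<gamma>_def)
  qed
  moreover have "0 \<le> 1 / cos (c / 2)"
    using assms cos_ge_zero[of "c / 2"] by simp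
  ultimately show ?thesis by blast
qed

text \<open>The path attains the mirror bound: it meets the tangent at 0 in \<open>p\<close>, in the
  direction \<open>pi - c\<close> of the reflected vector, and then walks perpendicularly onto the
  tangent at \<open>c\<close>.\<close>

lemma optimal_trajectory_reflect:
  assumes c: "2 * pi / 3 < c" "c \<le> 5 * pi / 6"
  shows "\<exists>\<gamma>. trajectory \<gamma> \<and>
    (\<forall>\<phi>\<in>{0..c}. \<exists>s. 0 \<le> s \<and> s \<le> 1 - 2 * cos c \<and> 1 \<le> \<gamma> s \<bullet> circle_pt \<phi>)"
proof -
  have "cos c \<le> cos (2 * (pi / 3))" using c by (intro cos_monotone_0_pi_le) auto
  then have C: "cos c \<le> - 1 / 2" by (simp only: cos_double_cos cos_60) (simp add: power2_eq_square)
  have "sin (pi / 6) \<le> sin (pi - c)" using c by (intro sin_monotone_2pi_le) auto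
  then have S: "1 / 2 \<le> sin c" by (simp add: sin_30)
  define r where "r = - 1 / cos c"
  define v where "v = 1 - 2 * cos c"
  have rc: "r * cos c = - 1" using C by (simp add: r_def)
  have r: "r > 0" using C by (simp add: r_def divide_neg_neg)
  \<comment> \<open>The second leg has nonnegative length \<open>v - r\<close>.\<close>
  have "(v - r) * - cos c = (- 2 * cos c - 1) * (1 - cos c)"
    using rc by (simp add: v_def algebra_simps)
  also have "\<dots> \<ge> 0" using C by (intro mult_nonneg_nonneg) auto
  finally have "0 \<le> v - r" using C by (subst (asm) zero_le_mult_iff) auto
  then have rv: "r \<le> v" by simp
  define p where "p = r *\<^sub>R circle_pt (pi - c)"
  define f where "f = (\<lambda>s. s *\<^sub>R circle_pt (pi - c))"
  define g where "g = (\<lambda>s. p + (s - r) *\<^sub>R circle_pt c)"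
  define \<gamma> where "\<gamma> = (\<lambda>s. if s \<le> r then f s else g s)"
  have "unit_speed_on {0..} \<gamma>"
    unfolding \<gamma>_def using r
    by (intro unit_speed_on_join) (auto simp: f_def g_def p_def intro: unit_speed_on_line unit_speed_on_ray)
  then have traj: "trajectory \<gamma>"
    using r by (intro trajectoryI) (simp_all add: \<gamma>_def f_def)
  have \<gamma>r: "\<gamma> r = p" by (simp add: \<gamma>_def f_def p_def)
  have \<gamma>v: "\<gamma> v = p + (v - r) *\<^sub>R circle_pt c"
    using rv by (cases "v = r") (simp_all add: \<gamma>_def g_def f_def p_def)
  have p0: "p \<bullet> circle_pt 0 = 1" using rc by (simp add: p_def)
  have eq: "pi - c - (c - pi / 2) = 3 / 2 * pi - 2 * c" by simp
  have "p \<bullet> circle_pt (c - pi / 2) = r * cos (3 / 2 * pi - 2 * c)"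
    unfolding p_def inner_scaleR_left inner_circle_pt eq ..
  also have "\<dots> = - (r * cos c) * (2 * sin c)"
    by (simp only: cos_diff cos_3over2_pi sin_3over2_pi sin_double) simp
  finally have p1: "p \<bullet> circle_pt (c - pi / 2) = 2 * sin c" using rc by simp
  have eq': "pi - c - c = pi - 2 * c" by simp
  have "p \<bullet> circle_pt c = r * cos (pi - 2 * c)"
    unfolding p_def inner_scaleR_left inner_circle_pt eq' ..
  also have "cos (pi - 2 * c) = 1 - 2 * (cos c)\<^sup>2"
    using cos_double_cos[of c] by simp
  also have "r * (1 - 2 * (cos c)\<^sup>2) = r - 2 * (r * cos c) * cos c"
    by (simp add: power2_eq_square algebra_simps)
  finally have p2: "p \<bullet> circle_pt c = r + 2 * cos c" using rc by simp
  \<comment> \<open>The second leg is orthogonal to \<open>circle_pt (c - pi / 2)\<close>, so both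
    its ends inspect this point, as \<open>2 * sin c \<ge> 1\<close>. The arc is split there:
    \<open>p\<close> inspects the part before it and the end of the path the part after it.\<close>
  have q1: "\<gamma> v \<bullet> circle_pt (c - pi / 2) = 2 * sin c"
    by (simp add: \<gamma>v inner_add_left p1)
  have q2: "\<gamma> v \<bullet> circle_pt c = 1"
    by (simp add: \<gamma>v inner_add_left p2) (simp add: v_def)
  have "\<exists>s. 0 \<le> s \<and> s \<le> v \<and> 1 \<le> \<gamma> s \<bullet> circle_pt \<phi>" if "\<phi> \<in> {0..c}" for \<phi>
  proof (cases "\<phi> \<le> c - pi / 2")
    case True
    have "1 \<le> \<gamma> r \<bullet> circle_pt \<phi>"
      unfolding \<gamma>r by (rule inner_circle_pt_between[of _ 0 "c - pi / 2"]) (use p0 p1 S True c that in auto)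
    then show ?thesis using r rv by (intro exI[of _ r]) auto
  next
    case False
    have "1 \<le> \<gamma> v \<bullet> circle_pt \<phi>"
      by (rule inner_circle_pt_between[of _ "c - pi / 2" c]) (use q1 q2 S False that in auto)
    then show ?thesis using r rv by (intro exI[of _ v]) auto
  qed
  with traj show ?thesis unfolding v_def by blast
qed

text \<open>Four legs: a ray to the intersection of the tangents at 0 and \<open>pi / 3\<close>, the
  tangent to the point at \<open>pi / 3\<close> (reached at time \<open>sqrt 3\<close>), the circle
  up to the angle \<open>c - pi / 2\<close> (reached at time \<open>w\<close>), and a tangential leg
  of length 1.\<close>

lemma optimal_trajectory_arc:
  assumes c: "5 * pi / 6 < c"
  shows "\<exists>\<gamma>. trajectory \<gamma> \<and>
    (\<forall>\<phi>\<in>{0..c}. \<exists>s. 0 \<le> s \<and> s \<le> 1 + sqrt 3 + c - 5 * pi / 6 \<and> 1 \<le> \<gamma> s \<bullet> circle_pt \<phi>)"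
proof -
  define b where "b = 2 * sqrt 3 / 3"
  define w where "w = sqrt 3 + c - 5 * pi / 6"
  have b: "0 < b" "b < sqrt 3" by (auto simp: b_def)
  have w: "sqrt 3 < w" using c by (simp add: w_def)
  define f1 where "f1 = (\<lambda>s. s *\<^sub>R circle_pt (pi / 6))"
  define f2 where "f2 = (\<lambda>s. circle_pt (pi / 3) + (s - sqrt 3) *\<^sub>R circle_pt (5 * pi / 6))"
  define f3 where "f3 = (\<lambda>s. circle_pt (s + (pi / 3 - sqrt 3)))"
  define f4 where "f4 = (\<lambda>s. circle_pt (c - pi / 2) + (s - w) *\<^sub>R circle_pt c)"
  define g3 where "g3 = (\<lambda>s. if s \<le> w then f3 s else f4 s)"
  define g2 where "g2 = (\<lambda>s. if s \<le> sqrt 3 then f2 s else g3 s)"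
  define \<gamma> where "\<gamma> = (\<lambda>s. if s \<le> b then f1 s else g2 s)"
  have "w + (pi / 3 - sqrt 3) = c - pi / 2" by (simp add: w_def)
  then have f34: "f3 w = f4 w" by (simp add: f3_def f4_def)
  have f23: "f2 (sqrt 3) = g3 (sqrt 3)" using w by (simp add: f2_def f3_def g3_def)
  have e56: "cos (5 * pi / 6) = - (sqrt 3 / 2)" "sin (5 * pi / 6) = 1 / 2"
    using cos_pi_minus[of "pi / 6"] sin_pi_minus[of "pi / 6"]
    by (simp_all add: cos_30 sin_30 field_simps)
  have "f1 b = f2 b"
    unfolding vec_eq_iff by (simp add: forall_2 f1_def f2_def circle_pt_def e56 cos_30 sin_30 cos_60 sin_60 b_def)
  then have f12: "f1 b = g2 b" using b by (simp add: g2_def)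
  have "unit_speed_on {sqrt 3..} g3"
    unfolding g3_def using w f34
    by (intro unit_speed_on_join) (auto simp: f3_def f4_def intro: unit_speed_on_line unit_speed_on_circle)
  then have "unit_speed_on {b..} g2"
    unfolding g2_def using b f23
    by (intro unit_speed_on_join) (auto simp: f2_def intro: unit_speed_on_line unit_speed_on_ray)
  then have "unit_speed_on {0..} \<gamma>"
    unfolding \<gamma>_def using b f12
    by (intro unit_speed_on_join) (auto simp: f1_def intro: unit_speed_on_line unit_speed_on_ray)
  then have "trajectory \<gamma>"
    using b by (intro trajectoryI) (simp_all add: \<gamma>_def f1_def)
  moreover have "\<exists>s. 0 \<le> s \<and> s \<le> w + 1 \<and> 1 \<le> \<gamma> s \<bullet> circle_pt \<phi>" if \<phi>: "\<phi> \<in> {0..c}" for \<phi>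
  proof -
    consider "\<phi> \<le> pi / 3" | "pi / 3 < \<phi>" "\<phi> \<le> c - pi / 2" | "c - pi / 2 < \<phi>" by linarith
    then show ?thesis
    proof cases
      case 1
      have "1 \<le> \<gamma> b \<bullet> circle_pt \<phi>"
        by (rule inner_circle_pt_between[of _ 0 "pi / 3"])
          (use 1 \<phi> in \<open>auto simp: \<gamma>_def f1_def b_def cos_30\<close>)
      then show ?thesis using b w by (intro exI[of _ b]) auto
    next
      case 2
      define s where "s = \<phi> - pi / 3 + sqrt 3"
      have s: "sqrt 3 < s" "s \<le> w" using 2 by (auto simp: s_def w_def)
      then have "\<gamma> s = circle_pt \<phi>" using b by (auto simp: \<gamma>_def g2_def g3_def f3_def s_def)
      then show ?thesis using s b by (intro exI[of _ s]) auto
    next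
      case 3
      \<comment> \<open>The path ends at the intersection of the tangents at
        \<open>c - pi / 2\<close> and \<open>c\<close>.\<close>
      have "\<gamma> (w + 1) = circle_pt (c - pi / 2) + circle_pt c"
        using b w by (simp add: \<gamma>_def g2_def g3_def f4_def)
      then have *: "\<gamma> (w + 1) \<bullet> circle_pt (c - pi / 2) = 1" "\<gamma> (w + 1) \<bullet> circle_pt c = 1"
        by (simp_all add: inner_add_left)
      have "1 \<le> \<gamma> (w + 1) \<bullet> circle_pt \<phi>"
        by (rule inner_circle_pt_between[of _ "c - pi / 2" c]) (use * 3 \<phi> in auto)
      then show ?thesis using b w by (intro exI[of _ "w + 1"]) auto
    qed
  qed
  moreover have "w + 1 = 1 + sqrt 3 + c - 5 * pi / 6" by (simp add: w_def)
  ultimately show ?thesis by (metis (no_types, lifting))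
qed

lemma optimal_trajectory:
  assumes "0 \<le> c"
  shows "\<exists>\<gamma>. trajectory \<gamma> \<and>
    (\<forall>\<phi>\<in>{0..c}. \<exists>s. 0 \<le> s \<and> s \<le> inspection_value c \<and> 1 \<le> \<gamma> s \<bullet> circle_pt \<phi>)"
proof -
  consider "c \<le> 2 * pi / 3" | "2 * pi / 3 < c" "c \<le> 5 * pi / 6" | "\<not> c \<le> 2 * pi / 3" "5 * pi / 6 < c" by linarith
  then show ?thesis
  proof cases
    case 1
    then show ?thesis using optimal_trajectory_ray[OF assms] by (simp add: inspection_value_def)
  next
    case 2
    then show ?thesis using optimal_trajectory_reflect by (simp add: inspection_value_def)
  next
    case 3
    then show ?thesis using optimal_trajectory_arc by (simp add: inspection_value_def)
  qed
qed

section \<open>The extended-real inspection cost\<close>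

lemma inspection_value_le_cost:
  assumes "0 \<le> c" "c \<le> 2 * pi" and feas: "feasible c \<gamma>"
  shows "ereal (inspection_value c) \<le> inspection_cost c \<gamma>"
proof (rule ccontr)
  assume "\<not> ?thesis"
  then have "inspection_cost c \<gamma> < ereal (inspection_value c)" by simp
  \<comment> \<open>A real \<open>T\<close> strictly between the cost and the claimed value bounds
    all first inspection times, which puts the real-valued lower bound in contradiction to
    \<open>T < inspection_value c\<close>.\<close>
  from ereal_dense2[OF this] obtain T
    where T: "inspection_cost c \<gamma> < ereal T" "T < inspection_value c" by auto
  have \<gamma>: "trajectory \<gamma>" using feas by (simp add: feasible_def)
  have *: "0 \<le> insp_time \<gamma> (circle_pt \<phi>) \<and> insp_time \<gamma> (circle_pt \<phi>) \<le> T \<and>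
      1 \<le> \<gamma> (insp_time \<gamma> (circle_pt \<phi>)) \<bullet> circle_pt \<phi>" if \<phi>: "\<phi> \<in> {0..c}" for \<phi>
  proof -
    obtain s where s: "0 \<le> s" "inspects (\<gamma> s) (circle_pt \<phi>)"
      using feas \<phi> unfolding feasible_def by blast
    have "ereal (insp_time \<gamma> (circle_pt \<phi>)) \<le> inspection_cost c \<gamma>"
      unfolding inspection_cost_def using \<phi> by (rule SUP_upper)
    then have "ereal (insp_time \<gamma> (circle_pt \<phi>)) < ereal T" using T(1) by (rule le_less_trans)
    then show ?thesis
      using insp_time_first(1,2)[OF \<gamma> s] by (simp add: inspects_circle_pt_iff)
  qed
  have "0 \<le> T" using *[of 0] assms(1) by auto
  then have "inspection_value c \<le> T"
    using inspection_value_le[OF \<gamma> assms(1,2)] * by blast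
  then show False using T(2) by simp
qed

theorem theorem1:
  fixes c :: real
  assumes "0 \<le> c" and "c \<le> 2 * pi"
  shows "let v = (if c \<le> 2 * pi / 3 then 1 / cos (c / 2)
                  else if c \<le> 5 * pi / 6 then 1 - 2 * cos c
                  else 1 + sqrt 3 + c - 5 * pi / 6)
         in (\<exists>\<gamma>. feasible c \<gamma> \<and> inspection_cost c \<gamma> = ereal v) \<and>
            (\<forall>\<gamma>. feasible c \<gamma> \<longrightarrow> ereal v \<le> inspection_cost c \<gamma>)"
proof -
  obtain \<gamma> where \<gamma>: "trajectory \<gamma>"
    and ins: "\<And>\<phi>. \<phi> \<in> {0..c} \<Longrightarrow> \<exists>s. 0 \<le> s \<and> s \<le> inspection_value c \<and> inspects (\<gamma> s) (circle_pt \<phi>)"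
    using optimal_trajectory[OF assms(1)] inspects_circle_pt_iff by metis
  have feas: "feasible c \<gamma>"
    using \<gamma> ins unfolding feasible_def by blast
  have "inspection_cost c \<gamma> \<le> ereal (inspection_value c)"
    unfolding inspection_cost_def
  proof (rule SUP_least)
    fix \<phi> assume "\<phi> \<in> {0..c}"
    then obtain s where "0 \<le> s" "s \<le> inspection_value c" "inspects (\<gamma> s) (circle_pt \<phi>)"
      using ins by blast
    then show "ereal (insp_time \<gamma> (circle_pt \<phi>)) \<le> ereal (inspection_value c)"
      using insp_time_first(3)[OF \<gamma>] by force
  qed
  then have "inspection_cost c \<gamma> = ereal (inspection_value c)"
    using inspection_value_le_cost[OF assms feas] by (rule antisym)
  then show ?thesis
    unfolding Let_def inspection_value_def[symmetric]
    using feas inspection_value_le_cost[OF assms] by blast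
qed

end
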